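(* Let $a,b,c,d\in\mathbb{Z}$, let $J_2=\begin{pmatrix}1&1\\0&1\end{pmatrix}$ and $\mathcal{D}=\{(a,b)^T,(c,d)^T\}$. Suppose that none of the following five conditions (each of which is a criterion for $(J_2,\mathcal{D})$ not to be a full number system) holds: (i) $bd<-1$ and $\gcd(ad-bc,\,|b|+|d|)\ge 3$; (ii) $b\equiv d\equiv 0 \pmod 2$; (iii) $b$ and $d$ are both odd, $b\equiv d\pmod 4$ and $a\equiv c\pmod 2$; (iv) $b$ and $d$ are both odd, $b\not\equiv d\pmod 4$ and $a\not\equiv c\pmod 2$; (v) $bd=-1$ and $a\not\equiv c\pmod 2$. Then $(J_2,\mathcal{D})$ is a full number system.
   Context: For $M\in\mathbb{Z}^{n\times n}$ and a finite set $\mathcal{D}\subset\mathbb{Z}^n$ (the digit set), a vector $v\in\mathbb{Z}^n$ has a representation in base $M$ with digit set $\mathcal{D}$ if there is a finite sequence $a_k,a_{k-1},\dots,a_0$ of elements of $\mathcal{D}$ with $v=M^ka_k+\dots+M a_1+a_0$. The pair $(M,\mathcal{D})$ is a full number system if every $v\in\mathbb{Z}^n$ has such a representation.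
   Formalization: The hypothesis bd < 0 is added: without it the claim is false, e.g. for (a,b) = (0,1), (c,d) = (0,0), where none of (i)–(v) holds but (0,−1) has no representation; bd < 0 is necessary for any full number system of this form. *)

theory Defs
  imports "HOL-Analysis.Analysis" "HOL-Number_Theory.Cong"
begin

(* The library's power operation ^ on square matrices is the componentwise one,
   hence a separate power with respect to the matrix product. *)
primrec matrix_power :: "'a::semiring_1^'n^'n \<Rightarrow> nat \<Rightarrow> 'a^'n^'n" where
  "matrix_power M 0 = mat 1"
| "matrix_power M (Suc k) = M ** matrix_power M k"

(* The digit string a k, ..., a 0 has length k + 1; the empty string is not allowed. *)
definition has_representation :: "int^'n^'n \<Rightarrow> (int^'n) set \<Rightarrow> int^'n \<Rightarrow> bool" where
  "has_representation M D v \<longleftrightarrow>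
     (\<exists>k::nat. \<exists>a::nat \<Rightarrow> int^'n.
        (\<forall>i\<le>k. a i \<in> D) \<and> v = (\<Sum>i\<le>k. matrix_power M i *v a i))"

definition full_number_system :: "int^'n^'n \<Rightarrow> (int^'n) set \<Rightarrow> bool" where
  "full_number_system M D \<longleftrightarrow> finite D \<and> (\<forall>v. has_representation M D v)"

definition J2 :: "int^2^2" where
  "J2 = vector [vector [1, 1], vector [0, 1]]"

lemma matrix_power_J2_snd: "(matrix_power J2 i *v x) $ 2 = x $ 2"
proof (induction i)
  case (Suc i)
  have "matrix_power J2 (Suc i) *v x = J2 *v (matrix_power J2 i *v x)"
    by (simp add: matrix_vector_mul_assoc)
  then show ?case
    using Suc by (simp add: matrix_vector_mult_def J2_def sum_2)
qed simp

(* The second coordinate of a represented vector is a sum of b's and d's, so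
   digits whose second coordinates do not have strictly opposite signs never
   give a full number system. *)
lemma full_number_system_J2_imp_opposite_signs:
  assumes "full_number_system J2 {vector [a, b], vector [c, d]}"
  shows "b * d < 0"
proof (rule ccontr)
  assume "\<not> b * d < 0"
  then consider "b \<ge> 0" "d \<ge> 0" | "b \<le> 0" "d \<le> 0"
    by (force simp: mult_less_0_iff)
  moreover have "\<exists>k x. (\<forall>i\<le>k::nat. x i \<in> {b, d}) \<and> z = (\<Sum>i\<le>k. x i)" for z :: int
  proof -
    obtain k e where e: "\<forall>i\<le>k::nat. e i \<in> {vector [a, b], vector [c, d]}"
      and z: "(vector [0, z] :: int^2) = (\<Sum>i\<le>k. matrix_power J2 i *v e i)"
      using assms unfolding full_number_system_def has_representation_def by blast
    have "z = (\<Sum>i\<le>k. e i $ 2)"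
      using arg_cong[OF z, of "\<lambda>v. v $ 2"] by (simp add: matrix_power_J2_snd)
    moreover have "\<forall>i\<le>k. e i $ 2 \<in> {b, d}"
    proof (intro allI impI)
      fix i assume "i \<le> k"
      then consider "e i = vector [a, b]" | "e i = vector [c, d]" using e by blast
      then show "e i $ 2 \<in> {b, d}" by cases simp_all
    qed
    ultimately show ?thesis by (intro exI[of _ k] exI[of _ "\<lambda>i. e i $ 2"] conjI)
  qed
  note rep = this
  obtain k x where x: "\<forall>i\<le>k::nat. x i \<in> {b, d}" "1 = (\<Sum>i\<le>k. x i)"
    using rep[of 1] by blast
  obtain l y where y: "\<forall>i\<le>l::nat. y i \<in> {b, d}" "-1 = (\<Sum>i\<le>l. y i)"
    using rep[of "-1"] by blast
  from calculation show False
  proof cases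
    case 1
    then have "(\<Sum>i\<le>l. y i) \<ge> 0" using y(1) by (metis sum_nonneg atMost_iff insert_iff singletonD)
    then show ?thesis using y(2) by simp
  next
    case 2
    then have "(\<Sum>i\<le>k. x i) \<le> 0" using x(1) by (metis sum_nonpos atMost_iff insert_iff singletonD)
    then show ?thesis using x(2) by simp
  qed
qed

end

theory Submission
  imports Defs
begin

text \<open>
  Say \<open>b > 0 > d\<close> and put \<open>m = b - d\<close>. A digit string of length \<open>n\<close> which uses \<open>(a, b)\<close> exactly
  at the positions in \<open>S\<close>, where \<open>card S = s\<close>, represents the vector with coordinates
  \<open>s a + (n - s) c + d n (n - 1) / 2 + m \<Sum>S\<close> and \<open>s b + (n - s) d\<close>. The second coordinate fixes
  \<open>(s, n - s)\<close> up to adding \<open>j (-d, b)\<close>, and \<open>\<Sum>S\<close> can be any integer in an interval whose length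
  is quadratic in \<open>j\<close>; for large \<open>j\<close> the required value lies in this interval. What remains is a
  congruence modulo \<open>m\<close>, whose left-hand side is affine in \<open>j\<close> with slope \<open>b c - a d\<close>, shifted
  by \<open>m / 2\<close> if \<open>m\<close> is even. The five conditions make this slope a unit modulo \<open>m\<close>.
\<close>

section \<open>Sums of subsets of an initial segment\<close>

lemma ex_subset_sum_eq:
  fixes s t r :: nat
  assumes "r \<le> s * t"
  shows "\<exists>S \<subseteq> {..<s + t}. card S = s \<and> \<Sum>S = \<Sum>{..<s} + r"
  using assms
proof (induction t)
  case 0
  then show ?case by (intro exI[of _ "{..<s}"]) auto
next
  case (Suc t)
  show ?case
  proof (cases "r \<le> s * t")
    case True
    with Suc.IH obtain S where "S \<subseteq> {..<s + t}" "card S = s" "\<Sum>S = \<Sum>{..<s} + r" by blast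
    then show ?thesis by (intro exI[of _ S]) auto
  next
    case False
    define u where "u = r - s * t"
    have u: "r = s * t + u" "u \<le> s" "1 \<le> u" using False Suc.prems by (auto simp: u_def)
    \<comment> \<open>Dropping the largest of the top \<open>s + 1\<close> elements leaves an excess
      of \<open>s * t\<close>; lowering the dropped element by \<open>u\<close> raises the sum by
      \<open>u\<close>.\<close>
    let ?S = "{t..t + s} - {t + s - u}"
    have "\<Sum>{t..t + s} = \<Sum>{..<s} + s * t + t + s" for s
      by (induction s) (auto simp: algebra_simps)
    moreover have "\<Sum>{t..t + s} = (t + s - u) + \<Sum>?S"
      using u by (intro sum.remove) auto
    ultimately have "\<Sum>?S = \<Sum>{..<s} + r" using u by simp
    moreover have "card ?S = s" using u by simp
    ultimately show ?thesis by (intro exI[of _ ?S]) auto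
  qed
qed

section \<open>Values of digit strings in base \<open>J2\<close>\<close>

lemma matrix_power_J2_mult_vector:
  "matrix_power J2 i *v vector [x, y] = vector [x + int i * y, y]"
proof (induction i)
  case (Suc i)
  have "matrix_power J2 (Suc i) *v vector [x, y] = J2 *v (matrix_power J2 i *v vector [x, y])"
    by (simp add: matrix_vector_mul_assoc)
  then show ?case
    using Suc by (simp add: vec_eq_iff forall_2 matrix_vector_mult_def J2_def sum_2 algebra_simps)
qed simp

lemma double_sum_lessThan: "2 * int (\<Sum>{..<n}) = int n * (int n - 1)"
  by (induction n) (auto simp: algebra_simps)

lemma has_representation_J2I:
  fixes a b c d :: int
  assumes S: "S \<subseteq> {..<n}" and "0 < n"
    and v1: "v $ 1 = int (card S) * (a - c) + int n * c + d * int (\<Sum>{..<n}) + (b - d) * int (\<Sum>S)"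
    and v2: "v $ 2 = int (card S) * (b - d) + int n * d"
  shows "has_representation J2 {vector [a, b], vector [c, d]} v"
proof -
  let ?e = "\<lambda>i. if i \<in> S then vector [a, b] else vector [c, d] :: int^2"
  obtain k where k: "n = Suc k" using \<open>0 < n\<close> by (cases n) auto
  have split: "(\<Sum>i<n. if i \<in> S then f i else g i) = (\<Sum>i<n. g i) + (\<Sum>i\<in>S. f i - g i)"
    for f g :: "nat \<Rightarrow> int"
  proof -
    have "(\<Sum>i\<in>S. f i - g i) = (\<Sum>i<n. if i \<in> S then f i - g i else 0)"
      using S by (subst sum.inter_restrict[symmetric]) (auto simp: Int_absorb1)
    then show ?thesis by (auto simp: sum.distrib[symmetric] intro!: sum.cong)
  qed
  have "(\<Sum>i<n. (matrix_power J2 i *v ?e i) $ 1)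
      = (\<Sum>i<n. if i \<in> S then a + int i * b else c + int i * d)"
    by (intro sum.cong) (auto simp: matrix_power_J2_mult_vector)
  also have "\<dots> = v $ 1"
    unfolding split v1
    by (simp add: sum.distrib sum_subtractf sum_distrib_left algebra_simps)
  finally have 1: "(\<Sum>i<n. (matrix_power J2 i *v ?e i) $ 1) = v $ 1" .
  have "(\<Sum>i<n. (matrix_power J2 i *v ?e i) $ 2) = (\<Sum>i<n. if i \<in> S then b else d)"
    by (intro sum.cong) (auto simp: matrix_power_J2_mult_vector)
  also have "\<dots> = v $ 2"
    unfolding split v2 by simp
  finally have "v = (\<Sum>i<n. matrix_power J2 i *v ?e i)"
    using 1 by (simp add: vec_eq_iff forall_2 sum_component)
  then show ?thesis
    unfolding has_representation_def
    by (intro exI[of _ k] exI[of _ ?e]) (auto simp: k lessThan_Suc_atMost)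
qed

section \<open>Large parameters in a prescribed residue class\<close>

lemma quadratic_eventually_nonneg:
  fixes A B C :: int
  assumes "A > 0" "j \<ge> \<bar>B\<bar> + \<bar>C\<bar>"
  shows "A * j\<^sup>2 + B * j + C \<ge> 0"
proof (cases "j = 0")
  case False
  then have j: "1 \<le> j" using assms by linarith
  have "\<bar>B\<bar> * j + \<bar>C\<bar> \<le> (\<bar>B\<bar> + \<bar>C\<bar>) * j"
    using j mult_left_mono[of 1 j "\<bar>C\<bar>"] by (simp add: algebra_simps)
  also have "\<dots> \<le> j\<^sup>2" using assms j by (simp add: power2_eq_square)
  also have "\<dots> \<le> A * j\<^sup>2" using \<open>A > 0\<close> by (simp add: mult_le_cancel_right1)
  finally have "\<bar>B\<bar> * j + \<bar>C\<bar> \<le> A * j\<^sup>2" .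
  moreover have "- (\<bar>B\<bar> * j) \<le> B * j" using j mult_right_mono[of "- \<bar>B\<bar>" B j] by simp
  ultimately show ?thesis by linarith
qed (use assms in auto)

lemma cong_affine_solution_ge:
  fixes m u w N :: int
  assumes "m > 0" "coprime u m"
  obtains j where "j \<ge> N" "[u * j = w] (mod m)"
proof -
  obtain i where i: "[u * i = 1] (mod m)" using cong_solve_coprime_int[OF assms(2)] by blast
  \<comment> \<open>The least integer from \<open>N\<close> on that is congruent to
    \<open>i * w\<close>.\<close>
  define j where "j = N + (i * w - N) mod m"
  have "[j = i * w] (mod m)" by (simp add: j_def cong_def mod_simps)
  then have "[u * j = (u * i) * w] (mod m)" by (simp add: cong_scalar_left mult.assoc)
  also have "[(u * i) * w = 1 * w] (mod m)" using i by (rule cong_scalar_right)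
  finally have "[u * j = w] (mod m)" by simp
  moreover have "j \<ge> N" using \<open>m > 0\<close> by (simp add: j_def)
  ultimately show ?thesis by (rule that[rotated])
qed

text \<open>Here \<open>T\<close> is the part of the triangular number of the length that is
  quadratic in \<open>j\<close>. The hypothesis \<open>slope\<close> says that modulo
  \<open>b - d\<close> it contributes only linearly, which keeps the parity of \<open>b - d\<close>
  out of this argument.\<close>

lemma full_number_system_J2I:
  fixes a b c d :: int
  assumes b: "b > 0" and d: "d < 0" and cop: "coprime b d"
    and u: "coprime u (b - d)"
    and slope: "\<And>j T. 2 * T = (b - d) * j * ((b - d) * j - 1) \<Longrightarrow>
      [d * T + (b * c - a * d) * j = u * j] (mod b - d)"
  shows "full_number_system J2 {vector [a, b], vector [c, d]}"
  unfolding full_number_system_def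
proof (intro conjI allI)
  fix v :: "int^2"
  define m where "m = b - d"
  have m: "m > 0" using b d by (simp add: m_def)
  obtain s0 t0 where st0: "s0 * b + t0 * d = v $ 2"
  proof -
    obtain x y where "x * b + y * d = 1"
      using cop bezout_int[of b d] by auto
    then have "(v $ 2 * x) * b + (v $ 2 * y) * d = v $ 2"
      by (metis distrib_left mult.assoc mult.right_neutral)
    then show ?thesis by (rule that)
  qed
  define L0 where "L0 = s0 + t0"
  define T0 where "T0 = L0 * (L0 - 1) div 2"
  have T0: "2 * T0 = L0 * (L0 - 1)" by (simp add: T0_def)
  define f0 where "f0 = v $ 1 - s0 * a - t0 * c - d * T0"
  \<comment> \<open>The required value of \<open>2 m \<Sum>S\<close> minus \<open>m s (s - 1)\<close> is the first quadratic in \<open>j\<close>, and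
    \<open>m s (s - 1) + 2 m s t\<close> minus that value is the second one.\<close>
  define B1 where "B1 = - 2 * (b * c - a * d) - d * m * (2 * L0 - 1) + m * d * (2 * s0 - 1)"
  define C1 where "C1 = 2 * f0 - m * s0 * (s0 - 1)"
  define B2 where "B2 = 2 * m * (s0 * b - t0 * d) - B1"
  define C2 where "C2 = 2 * m * s0 * t0 - C1"
  \<comment> \<open>One bound serves both quadratics and also makes \<open>s\<close> and
    \<open>t\<close> positive.\<close>
  obtain j where jN: "j \<ge> \<bar>B1\<bar> + \<bar>C1\<bar> + \<bar>B2\<bar> + \<bar>C2\<bar> + \<bar>s0\<bar> + \<bar>t0\<bar> + 1"
    and j: "[u * j = f0] (mod m)"
    using cong_affine_solution_ge[OF m u[folded m_def]] by blast
  define s where "s = s0 - d * j"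
  define t where "t = t0 + b * j"
  have j0: "j \<ge> 1" using jN by linarith
  have "(- d) * j \<ge> 1 * j" "b * j \<ge> 1 * j"
    using b d j0 by (intro mult_right_mono; simp)+
  then have st: "s \<ge> 1" "t \<ge> 1" using jN by (auto simp: s_def t_def)
  define T where "T = m * j * (m * j - 1) div 2"
  have "even (x * (x - 1))" for x :: int by simp
  then have T: "2 * T = m * j * (m * j - 1)"
    unfolding T_def by (metis dvd_mult_div_cancel)
  \<comment> \<open>The value that \<open>m\<close> times the sum of \<open>S\<close> must take;
    \<open>f0\<close> is its value at \<open>j = 0\<close>. The length is \<open>L0 + m * j\<close>,
    with triangular number \<open>T0 + T + L0 * m * j\<close>.\<close>
  define f where "f = f0 - (b * c - a * d) * j - d * (T + L0 * m * j)"
  have "[f0 - (d * T + (b * c - a * d) * j) - (d * L0 * j) * m = f0 - f0 - (d * L0 * j) * 0] (mod m)"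
    using cong_trans[OF slope[OF T[unfolded m_def]] j[unfolded m_def]]
    by (intro cong_diff cong_mult) (auto simp: m_def cong_def)
  then have "m dvd f"
    by (simp add: f_def cong_0_iff algebra_simps)
  then obtain g where g: "f = m * g" by blast
  have f2: "2 * f = 2 * f0 - 2 * (b * c - a * d) * j - d * (m * j * (m * j - 1) + 2 * L0 * m * j)"
    unfolding f_def T[symmetric] by (simp add: algebra_simps)
  \<comment> \<open>Both distances to the ends of the admissible interval have the same positive
    leading coefficient: asymptotically the required value is the midpoint.\<close>
  have q1: "2 * f - m * (s * (s - 1)) = (m * b * (- d)) * j\<^sup>2 + B1 * j + C1"
    unfolding f2 B1_def C1_def s_def m_def by (simp add: algebra_simps power2_eq_square)
  have q2: "m * (s * (s - 1)) + m * (2 * s * t) - 2 * f = (m * b * (- d)) * j\<^sup>2 + B2 * j + C2"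
    unfolding f2 B2_def C2_def B1_def C1_def s_def t_def m_def by (simp add: algebra_simps power2_eq_square)
  have A: "m * b * (- d) > 0" using m b d by (simp add: mult_pos_neg)
  have "m * (s * (s - 1)) \<le> 2 * f"
    using quadratic_eventually_nonneg[OF A, of B1 C1 j] jN q1 by linarith
  then have lo: "s * (s - 1) \<le> 2 * g" using m by (simp add: g)
  have "2 * f \<le> m * (s * (s - 1)) + m * (2 * s * t)"
    using quadratic_eventually_nonneg[OF A, of B2 C2 j] jN q2 by linarith
  also have "\<dots> = m * (s * (s - 1) + 2 * s * t)" by (simp add: algebra_simps)
  finally have hi: "2 * g \<le> s * (s - 1) + 2 * s * t" using m by (simp add: g)
  define s' t' where "s' = nat s" and "t' = nat t"
  have s't': "int s' = s" "int t' = t" using st by (auto simp: s'_def t'_def)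
  define r where "r = nat (g - int (\<Sum>{..<s'}))"
  have tri: "2 * int (\<Sum>{..<s'}) = s * (s - 1)" using double_sum_lessThan[of s'] s't' by simp
  have r: "int r = g - int (\<Sum>{..<s'})" using lo tri by (simp add: r_def)
  have "int r \<le> int (s' * t')" using r hi tri s't' by simp
  then obtain S where S: "S \<subseteq> {..<s' + t'}" "card S = s'" "\<Sum>S = \<Sum>{..<s'} + r"
    using ex_subset_sum_eq[of r s' t'] by (auto simp del: of_nat_mult)
  have Sg: "int (\<Sum>S) = g" using S(3) r by simp
  have n: "int (s' + t') = L0 + m * j"
    by (simp add: s't' s_def t_def L0_def m_def algebra_simps)
  have "2 * int (\<Sum>{..<s' + t'}) = 2 * (T0 + T + L0 * m * j)"
    unfolding double_sum_lessThan n using T T0 by (simp add: algebra_simps)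
  then have tn: "int (\<Sum>{..<s' + t'}) = T0 + T + L0 * m * j"
    by (simp only: mult_cancel_left) simp
  show "has_representation J2 {vector [a, b], vector [c, d]} v"
  proof (rule has_representation_J2I[OF S(1)])
    show "0 < s' + t'" using st s't' by linarith
    have "v $ 1 = f + s * a + t * c + d * (T0 + T + L0 * m * j)"
      by (simp add: f_def f0_def s_def t_def algebra_simps)
    then show "v $ 1 = int (card S) * (a - c) + int (s' + t') * c + d * int (\<Sum>{..<s' + t'})
        + (b - d) * int (\<Sum>S)"
      unfolding tn Sg S(2) by (simp add: s't' g m_def algebra_simps)
    show "v $ 2 = int (card S) * (b - d) + int (s' + t') * d"
      unfolding S(2) st0[symmetric] by (simp add: s't' s_def t_def algebra_simps)
  qed
qed simp

lemma slope_cong_odd: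
  fixes m j T d e :: int
  assumes "odd m" "2 * T = m * j * (m * j - 1)"
  shows "[d * T + e * j = e * j] (mod m)"
proof -
  have "m dvd 2 * T" using assms(2) by simp
  then have "m dvd T" using \<open>odd m\<close> by (simp add: coprime_dvd_mult_right_iff)
  then show ?thesis by (simp add: cong_iff_dvd_diff)
qed

text \<open>Here \<open>T\<close> is \<open>k * j\<close> times an odd number, and \<open>d\<close>
  is odd, so \<open>d * T\<close> is congruent to \<open>k * j\<close> modulo
  \<open>2 * k\<close>.\<close>

lemma slope_cong_even:
  fixes k j T d e :: int
  assumes "odd d" "2 * T = 2 * k * j * (2 * k * j - 1)"
  shows "[d * T + e * j = (e + k) * j] (mod 2 * k)"
proof -
  obtain h where h: "d = 2 * h + 1" using \<open>odd d\<close> by (elim oddE)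
  have "T = k * j * (2 * k * j - 1)" using assms(2) by simp
  then have "d * T + e * j - (e + k) * j = 2 * k * (k * j * j * d - j * (h + 1))"
    unfolding h by algebra
  then show ?thesis unfolding cong_iff_dvd_diff by simp
qed

text \<open>A common divisor of \<open>e + k\<close> and \<open>k\<close> divides both
  \<open>e\<close> and \<open>2 * k\<close>, hence 2, but it is odd because \<open>e + k\<close>
  is.\<close>

lemma coprime_add_half:
  fixes e k :: int
  assumes "gcd e (2 * k) dvd 2" "odd (e + k)"
  shows "coprime (e + k) (2 * k)"
proof -
  have "coprime (e + k) k"
  proof (rule coprimeI)
    fix x assume x: "x dvd e + k" "x dvd k"
    then have "x dvd e" by (simp add: dvd_add_left_iff)
    then have "x dvd 2" using x assms(1) by (meson dvd_mult dvd_trans gcd_greatest)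
    moreover have "odd x" using x(1) assms(2) dvd_trans by blast
    ultimately show "is_unit x"
      by (metis coprime_absorb_left coprime_right_2_iff_odd)
  qed
  then show ?thesis using assms(2) by simp
qed

lemma full_number_system_J2_pos_neg:
  fixes a b c d :: int
  assumes b: "b > 0" and d: "d < 0"
    and not_i: "\<not> (b * d < -1 \<and> gcd (a * d - b * c) (\<bar>b\<bar> + \<bar>d\<bar>) \<ge> 3)"
    and not_ii: "\<not> ([b = 0] (mod 2) \<and> [d = 0] (mod 2))"
    and not_iii: "\<not> (odd b \<and> odd d \<and> [b = d] (mod 4) \<and> [a = c] (mod 2))"
    and not_iv: "\<not> (odd b \<and> odd d \<and> \<not> [b = d] (mod 4) \<and> \<not> [a = c] (mod 2))"
    and not_v: "\<not> (b * d = -1 \<and> \<not> [a = c] (mod 2))"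
  shows "full_number_system J2 {vector [a, b], vector [c, d]}"
proof -
  define m where "m = b - d"
  define e where "e = b * c - a * d"
  have m: "m > 0" "\<bar>b\<bar> + \<bar>d\<bar> = m" using b d by (auto simp: m_def)
  have bd: "b * d \<le> -1" using mult_pos_neg[OF b d] by linarith
  \<comment> \<open>Condition (i) says nothing when \<open>b * d = -1\<close>, but then
    \<open>m = 2\<close>.\<close>
  have gcd2: "gcd e m dvd 2"
  proof (cases "b * d = -1")
    case True
    then have "b dvd 1" "d dvd 1" by (metis dvd_minus_iff dvd_triv_left dvd_triv_right)+
    then have "m = 2" using b d by (simp add: m_def)
    then show ?thesis by simp
  next
    case False
    have "gcd (a * d - b * c) m = gcd e m"
      unfolding e_def by (metis gcd_neg1 minus_diff_eq)
    with False bd not_i m have "gcd e m < 3" by force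
    moreover have "gcd e m > 0" using m by simp
    ultimately have "gcd e m = 1 \<or> gcd e m = 2" by linarith
    then show ?thesis by (elim disjE) simp_all
  qed
  \<comment> \<open>Both \<open>e\<close> and \<open>m\<close> are integer combinations of
    \<open>b\<close> and \<open>d\<close>.\<close>
  have "gcd b d dvd gcd e m" by (simp add: e_def m_def)
  then have "gcd b d dvd 2" using gcd2 dvd_trans by blast
  then have "gcd b d \<le> 2" "gcd b d > 0" using b zdvd_imp_le[of "gcd b d" 2] by auto
  moreover have "gcd b d \<noteq> 2"
    using not_ii by (metis cong_0_iff gcd_dvd1 gcd_dvd2)
  ultimately have "gcd b d = 1" by linarith
  then have cop: "coprime b d" by (simp add: coprime_iff_gcd_eq_1)
  show ?thesis
  proof (cases "even m")
    case False
    have "coprime e m"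
    proof (rule coprimeI)
      fix x assume x: "x dvd e" "x dvd m"
      then have "x dvd 2" using gcd2 dvd_trans gcd_greatest by blast
      moreover have "odd x" using x(2) False dvd_trans by blast
      ultimately show "is_unit x" by (metis coprime_absorb_left coprime_right_2_iff_odd)
    qed
    then show ?thesis
      using slope_cong_odd[OF False]
      by (intro full_number_system_J2I[OF b d cop, of e]) (auto simp: m_def e_def)
  next
    case True
    then obtain k where k: "m = 2 * k" by blast
    have "even b \<longleftrightarrow> even d" using True by (simp add: m_def)
    then have odd: "odd b" "odd d" using not_ii by (auto simp: cong_0_iff)
    \<comment> \<open>Conditions (iii) and (iv) thus say that \<open>k\<close> and \<open>e\<close>
      are both even or both odd; excluding them makes \<open>e + k\<close> odd.\<close>
    have "[b = d] (mod 4) \<longleftrightarrow> even k"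
      unfolding cong_iff_dvd_diff m_def[symmetric] k
      using dvd_mult_cancel_left[of 2 2 k] by simp
    moreover have "[a = c] (mod 2) \<longleftrightarrow> even e"
      using odd by (auto simp: cong_iff_dvd_diff e_def)
    ultimately have "odd (e + k)" using odd not_iii not_iv by auto
    then have "coprime (e + k) m" using coprime_add_half[of e k] gcd2 by (simp add: k)
    then show ?thesis
      using slope_cong_even[OF odd(2), of _ k _ e] k
      by (intro full_number_system_J2I[OF b d cop, of "e + k"])
        (simp_all add: m_def[symmetric] e_def[symmetric])
  qed
qed

text \<open>The sign hypothesis is necessary by
  \<open>full_number_system_J2_imp_opposite_signs\<close> and does not follow from the failure of
  the five conditions: take \<open>a = 0\<close> and \<open>b = c = d = 1\<close>.\<close>

theorem theorem3p6:
  fixes a b c d :: int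
  assumes opposite_signs: "b * d < 0"
    and not_i: "\<not> (b * d < -1 \<and> gcd (a * d - b * c) (\<bar>b\<bar> + \<bar>d\<bar>) \<ge> 3)"
    and not_ii: "\<not> ([b = 0] (mod 2) \<and> [d = 0] (mod 2))"
    and not_iii: "\<not> (odd b \<and> odd d \<and> [b = d] (mod 4) \<and> [a = c] (mod 2))"
    and not_iv: "\<not> (odd b \<and> odd d \<and> \<not> [b = d] (mod 4) \<and> \<not> [a = c] (mod 2))"
    and not_v: "\<not> (b * d = -1 \<and> \<not> [a = c] (mod 2))"
  shows "full_number_system J2 {vector [a, b], vector [c, d]}"
proof -
  consider "b > 0" "d < 0" | "d > 0" "b < 0" using opposite_signs by (auto simp: mult_less_0_iff)
  then show ?thesis
  proof cases
    case 1
    then show ?thesis using assms by (intro full_number_system_J2_pos_neg)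
  next
    case 2
    \<comment> \<open>Exchanging the digits only changes the sign of the determinant.\<close>
    have "gcd (c * b - d * a) (\<bar>d\<bar> + \<bar>b\<bar>) = gcd (a * d - b * c) (\<bar>b\<bar> + \<bar>d\<bar>)"
      by (metis add.commute gcd_neg1 minus_diff_eq mult.commute)
    with 2 have "full_number_system J2 {vector [c, d], vector [a, b]}"
      using assms
      by (intro full_number_system_J2_pos_neg) (auto simp: mult.commute cong_sym_eq)
    then show ?thesis by (simp add: insert_commute)
  qed
qed

end
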